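(* Let $d=2$ and consider a constant magnetic field with field strength $B>0$, with magnetic potential $\mathbf A(x)=\frac B2\,(x_2,-x_1)$, $x=(x_1,x_2)\in\mathbb R^2$. With $\mu_{\mathbf B}$, $\nu_{\mathbf B}$, $\mu_{\mathrm{Gauss}}$ and $\nu_{\mathrm{Gauss}}$ as defined in the context, we have $$\mu_{\mathbf B}(\alpha)\le\mu_{\mathrm{Gauss}}(\alpha)\quad\text{if}\quad p>2\qquad\text{and}\qquad\nu_{\mathbf B}(\beta)\le\nu_{\mathrm{Gauss}}(\beta)\quad\text{if}\quad p\in(1,2).$$
   Context: $\|\cdot\|_q$ is the norm of $\mathrm L^q(\mathbb R^2)$. $\nabla_{\mathbf A}:=\nabla+i\,\mathbf A$ and $\mathrm H^1_{\mathbf A}(\mathbb R^2):=\{\psi\in\mathrm L^2(\mathbb R^2):\nabla_{\mathbf A}\psi\in\mathrm L^2(\mathbb R^2)\}$. For $p\in(2,+\infty)$ and $\alpha>-B$, $\mu_{\mathbf B}(\alpha)$ is the optimal (largest) constant such that $\|\nabla_{\mathbf A}\psi\|_2^2+\alpha\|\psi\|_2^2\ge\mu_{\mathbf B}(\alpha)\|\psi\|_p^2$ for all $\psi\in\mathrm H^1_{\mathbf A}(\mathbb R^2)$. For $p\in(1,2)$ and $\beta>0$, $\nu_{\mathbf B}(\beta)$ is the optimal (largest) constant such that $\|\nabla_{\mathbf A}\psi\|_2^2+\beta\|\psi\|_p^2\ge\nu_{\mathbf B}(\beta)\|\psi\|_2^2$ for all $\psi\in\mathrm H^1_{\mathbf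 A}(\mathbb R^2)$. Let $\mathcal Q_\alpha^{(p)}[\psi]:=\frac{\|\nabla_{\mathbf A}\psi\|_2^2+\alpha\|\psi\|_2^2}{\|\psi\|_p^2}$ if $p>2$, and $\mathcal Q_\beta^{(p)}[\psi]:=\frac{\|\nabla_{\mathbf A}\psi\|_2^2+\beta\|\psi\|_p^2}{\|\psi\|_2^2}$ if $p\in(1,2)$. The test functions are $v_\sigma(r)=e^{-r^2/(2\sigma)}$, $r=|x|$, $\sigma>0$, for which the norms are given as $\|\nabla_{\mathbf A}v_\sigma\|_2^2=\frac\pi4\,(4+\sigma^2)$, $\|v_\sigma\|_2^2=\pi\,\sigma$, $\|v_\sigma\|_p^2=\big(\frac2p\,\pi\,\sigma\big)^{2/p}$. Let $\theta:=2/p$. Definition of $\mu_{\mathrm{Gauss}}$ ($p>2$): $\mathcal Q_\alpha^{(p)}[v_\sigma]=\frac18\,(2\pi)^{1-\theta}\,p^\theta\,f_{\alpha,\theta}(\sigma)$ with $f_{\alpha,\theta}(\sigma):=\sigma^{2-\theta}+4\,\alpha\,\sigma^{1-\theta}+4\,\sigma^{-\theta}$. The function $f_{\alpha,\theta}$ has a unique minimum on $(0,+\infty)$, determined by $(2-\theta)\,\sigma^2+4\,\alpha\,(1-\theta)\,\sigma-4\,\theta=0$, namely $\sigma=\sigma_+(\alpha,\theta)$ with $$\sigma_+(\alpha,\theta):=2\,\frac{\sqrt{\alpha^2(1-\theta)^2+\theta(2-\theta)}-\alpha(1-\theta)}{2-\theta},$$ and $$\mu_{\mathrm{Gauss}}(\alpha):=\mathcal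 Q_\alpha^{(p)}[v_{\sigma_+(\alpha,\theta)}]=\tfrac18\,(2\pi)^{1-\theta}\,p^\theta\,f_{\alpha,\theta}\big(\sigma_+(\alpha,\theta)\big).$$ Definition of $\nu_{\mathrm{Gauss}}$ ($p\in(1,2)$): with $\kappa(\beta,\theta):=8\,\theta^\theta\,\pi^{1-\theta}\,\beta$, $\mathcal Q_\beta^{(p)}[v_\sigma]=\frac18\,g_{\beta,\theta}(\sigma)$ where $g_{\beta,\theta}(\sigma):=\sigma+\frac2\sigma+\kappa(\beta,\theta)\,\sigma^{\theta-1}$. The function $g_{\beta,\theta}$ has a unique minimum $\sigma=\sigma_-(\beta,\theta)$ on $(0,+\infty)$, determined by $1-\frac2{\sigma^2}+\kappa(\beta,\theta)\,(\theta-1)\,\sigma^{\theta-2}=0$, and $$\nu_{\mathrm{Gauss}}(\beta):=\mathcal Q_\beta^{(p)}[v_{\sigma_-(\beta,\theta)}]=\tfrac18\,g_{\beta,\theta}\big(\sigma_-(\beta,\theta)\big)=\frac18\Big(\frac{2\,\theta}{\theta-1}\,\frac1{\sigma_-(\beta,\theta)}+\frac{\theta-2}{\theta-1}\,\sigma_-(\beta,\theta)\Big).$$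
   Formalization: The gradient norm of v_σ is corrected to (π/4)(4+B²σ²) (printed for B=1 only), so σ₊ carries B²; g is corrected to 2B²σ+8/σ+κσ^{θ-1} with κ=8θ^θπ^{θ-1}β. The Gaussian values are the quotients Q[v_σ] at these σ±; with the printed g, ν_B≤ν_Gauss fails for B=1 and small β. *)

theory Defs
  imports "HOL-Analysis.Analysis"
begin

text \<open>
  The plane is \<open>real \<times> real\<close>, whose norm is the Euclidean one, with Lebesgue measure \<open>lborel\<close>;
  the norm on \<open>complex \<times> complex\<close> is the Hermitian norm of a complex 2-vector.
\<close>

subsection \<open>Lebesgue norms\<close>

text \<open>
  Norms are extended reals: for \<open>p < 2\<close> an element of the magnetic Sobolev space need not belong
  to \<open>L\<^sup>p\<close>, and then its \<open>L\<^sup>p\<close> norm must be \<open>\<infinity>\<close> (a Bochner integral would return \<open>0\<close>).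
\<close>

definition Lnorm :: "real \<Rightarrow> (real \<times> real \<Rightarrow> 'b::real_normed_vector) \<Rightarrow> ereal" where
  "Lnorm q f =
     (let I = (\<integral>\<^sup>+x. ennreal (norm (f x) powr q) \<partial>lborel)
      in if I = \<infinity> then \<infinity> else ereal (enn2real I powr (1 / q)))"

definition L2 :: "(real \<times> real \<Rightarrow> 'b::real_normed_vector) set" where
  "L2 = {f. f \<in> borel_measurable lborel \<and> Lnorm 2 f < \<infinity>}"


subsection \<open>Weak derivatives\<close>

primrec Ck :: "nat \<Rightarrow> (real \<times> real \<Rightarrow> real) \<Rightarrow> bool" where
  "Ck 0 \<phi> \<longleftrightarrow> continuous_on UNIV \<phi>"
| "Ck (Suc k) \<phi> \<longleftrightarrow>
     (\<exists>\<phi>1 \<phi>2. (\<forall>x. (\<phi> has_derivative (\<lambda>h. fst h * \<phi>1 x + snd h * \<phi>2 x)) (at x))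
            \<and> Ck k \<phi>1 \<and> Ck k \<phi>2)"

text \<open>
  Real-valued test functions suffice: complex-valued ones are complex combinations of these and
  the pairing below is complex linear.
\<close>

definition test_function :: "(real \<times> real \<Rightarrow> real) \<Rightarrow> bool" where
  "test_function \<phi> \<longleftrightarrow> (\<forall>k. Ck k \<phi>) \<and> compact (closure {x. \<phi> x \<noteq> 0})"

definition loc_integrable :: "(real \<times> real \<Rightarrow> complex) \<Rightarrow> bool" where
  "loc_integrable f \<longleftrightarrow>
     f \<in> borel_measurable lborel \<and> (\<forall>K. compact K \<longrightarrow> set_integrable lborel K f)"

text \<open>\<open>g\<close> is the distributional derivative of \<open>\<psi>\<close> in the direction \<open>e\<close>.\<close>

definition has_weak_derivative ::
    "(real \<times> real \<Rightarrow> complex) \<Rightarrow> real \<times> real \<Rightarrow> (real \<times> real \<Rightarrow> complex) \<Rightarrow> bool" where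
  "has_weak_derivative \<psi> e g \<longleftrightarrow>
     loc_integrable \<psi> \<and> loc_integrable g \<and>
     (\<forall>\<phi>. test_function \<phi> \<longrightarrow>
        (LINT x|lborel. \<psi> x * of_real (frechet_derivative \<phi> (at x) e))
          = - (LINT x|lborel. g x * of_real (\<phi> x)))"


subsection \<open>Magnetic gradient and magnetic Sobolev space\<close>

definition potential :: "real \<Rightarrow> real \<times> real \<Rightarrow> real \<times> real" where
  "potential B x = (B / 2 * snd x, - (B / 2 * fst x))"

definition has_magnetic_gradient ::
    "real \<Rightarrow> (real \<times> real \<Rightarrow> complex) \<Rightarrow> (real \<times> real \<Rightarrow> complex \<times> complex) \<Rightarrow> bool" where
  "has_magnetic_gradient B \<psi> G \<longleftrightarrow>
     (\<exists>g1 g2. has_weak_derivative \<psi> (1, 0) g1 \<and> has_weak_derivative \<psi> (0, 1) g2 \<and>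
        G = (\<lambda>x. (g1 x + \<i> * of_real (fst (potential B x)) * \<psi> x,
                  g2 x + \<i> * of_real (snd (potential B x)) * \<psi> x)))"

text \<open>The choice is harmless: two magnetic gradients of \<open>\<psi>\<close> agree almost everywhere.\<close>

definition magnetic_gradient ::
    "real \<Rightarrow> (real \<times> real \<Rightarrow> complex) \<Rightarrow> real \<times> real \<Rightarrow> complex \<times> complex" where
  "magnetic_gradient B \<psi> = (SOME G. has_magnetic_gradient B \<psi> G)"

definition H1A :: "real \<Rightarrow> (real \<times> real \<Rightarrow> complex) set" where
  "H1A B = {\<psi> \<in> L2. \<exists>G \<in> L2. has_magnetic_gradient B \<psi> G}"


subsection \<open>Optimal constants\<close>

text \<open>
  The admissible constants form a closed down-set of reals, so the largest one is their
  supremum; it is taken in \<open>ereal\<close> so that it denotes the right object without a prior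
  proof that admissible constants exist.
\<close>

definition mu :: "real \<Rightarrow> real \<Rightarrow> real \<Rightarrow> ereal" where
  "mu B p \<alpha> = Sup (ereal ` {C. \<forall>\<psi> \<in> H1A B.
      (Lnorm 2 (magnetic_gradient B \<psi>))\<^sup>2 + ereal \<alpha> * (Lnorm 2 \<psi>)\<^sup>2
        \<ge> ereal C * (Lnorm p \<psi>)\<^sup>2})"

definition nu :: "real \<Rightarrow> real \<Rightarrow> real \<Rightarrow> ereal" where
  "nu B p \<beta> = Sup (ereal ` {C. \<forall>\<psi> \<in> H1A B.
      (Lnorm 2 (magnetic_gradient B \<psi>))\<^sup>2 + ereal \<beta> * (Lnorm p \<psi>)\<^sup>2
        \<ge> ereal C * (Lnorm 2 \<psi>)\<^sup>2})"


subsection \<open>Gaussian test functions\<close>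

definition Q_mu :: "real \<Rightarrow> real \<Rightarrow> real \<Rightarrow> (real \<times> real \<Rightarrow> complex) \<Rightarrow> ereal" where
  "Q_mu B p \<alpha> \<psi> =
     ((Lnorm 2 (magnetic_gradient B \<psi>))\<^sup>2 + ereal \<alpha> * (Lnorm 2 \<psi>)\<^sup>2) / (Lnorm p \<psi>)\<^sup>2"

definition Q_nu :: "real \<Rightarrow> real \<Rightarrow> real \<Rightarrow> (real \<times> real \<Rightarrow> complex) \<Rightarrow> ereal" where
  "Q_nu B p \<beta> \<psi> =
     ((Lnorm 2 (magnetic_gradient B \<psi>))\<^sup>2 + ereal \<beta> * (Lnorm p \<psi>)\<^sup>2) / (Lnorm 2 \<psi>)\<^sup>2"

definition gauss :: "real \<Rightarrow> real \<times> real \<Rightarrow> complex" where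
  "gauss \<sigma> x = of_real (exp (- (norm x)\<^sup>2 / (2 * \<sigma>)))"

text \<open>
  For field strength \<open>B\<close> one has \<open>\<parallel>\<nabla>\<^sub>A v\<^sub>\<sigma>\<parallel>\<^sup>2 = \<pi>/4 (4 + B\<^sup>2 \<sigma>\<^sup>2)\<close>,
  \<open>\<parallel>v\<^sub>\<sigma>\<parallel>\<^sup>2 = \<pi> \<sigma>\<close> and \<open>\<parallel>v\<^sub>\<sigma>\<parallel>\<^sub>p\<^sup>2 = (\<theta> \<pi> \<sigma>) powr \<theta>\<close> with \<open>\<theta> = 2/p\<close>. Hence
  \<open>Q_mu B p \<alpha> (gauss \<sigma>)\<close> is \<open>1/8 (2\<pi>) powr (1 - \<theta>) * p powr \<theta>\<close> times
  \<open>B\<^sup>2 \<sigma> powr (2 - \<theta>) + 4 \<alpha> \<sigma> powr (1 - \<theta>) + 4 \<sigma> powr (-\<theta>)\<close>, whose unique minimum point on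
  \<open>\<sigma> > 0\<close> is the positive root of \<open>B\<^sup>2 (2 - \<theta>) \<sigma>\<^sup>2 + 4 \<alpha> (1 - \<theta>) \<sigma> - 4 \<theta> = 0\<close>.
\<close>

definition sigma_plus :: "real \<Rightarrow> real \<Rightarrow> real \<Rightarrow> real" where
  "sigma_plus B \<alpha> \<theta> =
     2 * (sqrt (\<alpha>\<^sup>2 * (1 - \<theta>)\<^sup>2 + B\<^sup>2 * \<theta> * (2 - \<theta>)) - \<alpha> * (1 - \<theta>)) / (B\<^sup>2 * (2 - \<theta>))"

definition mu_Gauss :: "real \<Rightarrow> real \<Rightarrow> real \<Rightarrow> ereal" where
  "mu_Gauss B p \<alpha> = Q_mu B p \<alpha> (gauss (sigma_plus B \<alpha> (2 / p)))"

definition kappa :: "real \<Rightarrow> real \<Rightarrow> real" where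
  "kappa \<beta> \<theta> = 8 * \<theta> powr \<theta> * pi powr (\<theta> - 1) * \<beta>"

text \<open>\<open>Q_nu B p \<beta> (gauss \<sigma>) = 1/8 * g_nu B \<beta> (2/p) \<sigma>\<close> for \<open>\<sigma> > 0\<close>, by the same norms.\<close>

definition g_nu :: "real \<Rightarrow> real \<Rightarrow> real \<Rightarrow> real \<Rightarrow> real" where
  "g_nu B \<beta> \<theta> \<sigma> = 2 * B\<^sup>2 * \<sigma> + 8 / \<sigma> + kappa \<beta> \<theta> * \<sigma> powr (\<theta> - 1)"

definition sigma_minus :: "real \<Rightarrow> real \<Rightarrow> real \<Rightarrow> real" where
  "sigma_minus B \<beta> \<theta> = arg_min (g_nu B \<beta> \<theta>) (\<lambda>\<sigma>. 0 < \<sigma>)"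

definition nu_Gauss :: "real \<Rightarrow> real \<Rightarrow> real \<Rightarrow> ereal" where
  "nu_Gauss B p \<beta> = Q_nu B p \<beta> (gauss (sigma_minus B \<beta> (2 / p)))"

end

theory Submission
  imports Defs "HOL-Probability.Distributions"
begin

text \<open>
  Gaussians belong to the magnetic Sobolev space, so each of them is an admissible competitor in
  the inequality that defines the optimal constant, and the optimal constant is at most its
  quotient. No norm has to be computed: one only needs that the norm in the denominator is positive
  and finite, and that the selected width is positive.
\<close>

subsection \<open>Classical derivatives are weak derivatives\<close>

text \<open>The function equals its product with the indicator of a compact square, and continuity
  makes that product integrable. The support condition is coordinatewise so that it restricts
  directly to horizontal and vertical lines.\<close>

lemma integrable_continuous_box_support:
  fixes g :: "real \<times> real \<Rightarrow> real"
  assumes cont: "continuous_on UNIV g"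
    and supp: "\<And>x y. R < \<bar>x\<bar> \<or> R < \<bar>y\<bar> \<Longrightarrow> g (x, y) = 0"
  shows "integrable lborel g"
proof -
  let ?K = "{-R..R} \<times> {-R..R}"
  have "integrable lborel (\<lambda>z. indicator ?K z *\<^sub>R g z)"
    by (intro borel_integrable_compact compact_Times compact_Icc
        continuous_on_subset[OF cont subset_UNIV])
  also have "(\<lambda>z. indicator ?K z *\<^sub>R g z) = g"
  proof
    fix z
    show "indicator ?K z *\<^sub>R g z = g z"
    proof (cases "R < \<bar>fst z\<bar> \<or> R < \<bar>snd z\<bar>")
      case True
      then show ?thesis
        using supp[of "fst z" "snd z"] by simp
    next
      case False
      then have "z \<in> ?K"
        by (simp add: mem_Times_iff abs_le_iff not_less)
      then show ?thesis
        by simp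
    qed
  qed
  finally show ?thesis .
qed

text \<open>By Fubini with \<open>x\<close> innermost, the fundamental theorem of calculus turns
  each inner integral into boundary values of \<open>f\<close> outside the support. For
  \<open>f\<close> a product with a test function this is integration by parts.\<close>

lemma integral_partial_fst_eq_0:
  fixes f f' :: "real \<times> real \<Rightarrow> real"
  assumes deriv: "\<And>x y. ((\<lambda>t. f (t, y)) has_real_derivative f' (x, y)) (at x)"
    and cont: "continuous_on UNIV f'"
    and supp: "\<And>x y. R < \<bar>x\<bar> \<or> R < \<bar>y\<bar> \<Longrightarrow> f (x, y) = 0"
    and "R \<ge> 0"
  shows "integrable lborel f'" "(LINT z|lborel. f' z) = 0"
proof -
  \<comment> \<open>The support hypothesis concerns \<open>f\<close>. It passes to \<open>f'\<close>
    because the strict inequalities define an open set, so \<open>f\<close> vanishes along a whole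
    neighbourhood of \<open>x\<close> on the line.\<close>
  have out: "f' (x, y) = 0" if xy: "R < \<bar>x\<bar> \<or> R < \<bar>y\<bar>" for x y
  proof -
    define S where "S = {t. R < \<bar>t\<bar> \<or> R < \<bar>y\<bar>}"
    have "open S"
      unfolding S_def by (intro open_Collect_disj open_Collect_less continuous_intros)
    have "((\<lambda>t. 0) has_real_derivative f' (x, y)) (at x)"
      by (rule has_field_derivative_transform_within_open[OF deriv \<open>open S\<close>]) (use xy in \<open>auto simp: S_def supp\<close>)
    then show ?thesis
      using DERIV_unique[OF _ DERIV_const] by blast
  qed
  show int: "integrable lborel f'"
    by (rule integrable_continuous_box_support[OF cont out])
  have inner: "(LINT x|lborel. f' (x, y)) = 0" for y
  proof -
    \<comment> \<open>The interval extends to \<open>R+1\<close> so that both endpoints satisfy the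
      strict inequality in \<open>supp\<close>.\<close>
    have "(LINT x|lborel. f' (x, y)) = (LINT x|lborel. indicator {-(R+1)..R+1} x *\<^sub>R f' (x, y))"
    proof (rule Bochner_Integration.integral_cong)
      show "f' (x, y) = indicator {-(R+1)..R+1} x *\<^sub>R f' (x, y)" for x
        using out[of x y] by (cases "R < \<bar>x\<bar>") (auto simp: indicator_def)
    qed simp
    also have "\<dots> = f (R+1, y) - f (-(R+1), y)"
    proof (rule integral_FTC_Icc)
      show "((\<lambda>x. f (x, y)) has_vector_derivative f' (x, y)) (at x within {-(R+1)..R+1})" for x
        using deriv by (simp add: has_real_derivative_iff_has_vector_derivative
            has_vector_derivative_at_within)
      show "continuous_on {-(R+1)..R+1} (\<lambda>x. f' (x, y))"
        by (intro continuous_on_compose2[OF cont] continuous_intros) auto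
    qed (use \<open>R \<ge> 0\<close> in auto)
    also have "\<dots> = 0"
      using supp \<open>R \<ge> 0\<close> by simp
    finally show ?thesis .
  qed
  have "(LINT z|lborel. f' z) = (LINT z|(lborel \<Otimes>\<^sub>M lborel). f' z)"
    by (simp add: lborel_prod)
  also have "\<dots> = (LINT y|lborel. LINT x|lborel. f' (x, y))"
    using lborel_pair.integral_snd[of "\<lambda>x y. f' (x, y)"] int by (simp add: lborel_prod)
  finally show "(LINT z|lborel. f' z) = 0"
    using inner by simp
qed

text \<open>Swapping the coordinates preserves Lebesgue measure on the plane and reduces this to the
  first coordinate.\<close>

lemma integral_partial_snd_eq_0:
  fixes f f' :: "real \<times> real \<Rightarrow> real"
  assumes deriv: "\<And>x y. ((\<lambda>t. f (x, t)) has_real_derivative f' (x, y)) (at y)"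
    and cont: "continuous_on UNIV f'"
    and supp: "\<And>x y. R < \<bar>x\<bar> \<or> R < \<bar>y\<bar> \<Longrightarrow> f (x, y) = 0"
    and "R \<ge> 0"
  shows "integrable lborel f'" "(LINT z|lborel. f' z) = 0"
proof -
  have cont': "continuous_on UNIV (\<lambda>(x, y). f' (y, x))"
    unfolding case_prod_unfold
    by (intro continuous_on_compose2[OF cont] continuous_intros) auto
  have *: "integrable lborel (\<lambda>(x, y). f' (y, x))" "(LINT (x, y)|lborel. f' (y, x)) = 0"
    by (rule integral_partial_fst_eq_0[where f = "\<lambda>(x, y). f (y, x)" and R = R];
        use deriv supp cont' \<open>R \<ge> 0\<close> in auto)+
  have [measurable]: "f' \<in> borel_measurable borel"
    using cont by (rule borel_measurable_continuous_onI)
  show "integrable lborel f'"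
    using *(1) lborel_pair.integrable_product_swap_iff[of f'] by (simp add: lborel_prod)
  show "(LINT z|lborel. f' z) = 0"
    using *(2) lborel_pair.integral_product_swap[of f'] by (simp add: lborel_prod)
qed

text \<open>The chain rule along an embedded coordinate line turns the form of derivative used in
  \<open>Ck\<close> into the one-variable form needed for the fundamental theorem of
  calculus.\<close>

lemma partial_derivatives:
  fixes f f1 f2 :: "real \<times> real \<Rightarrow> real"
  assumes "\<And>z. (f has_derivative (\<lambda>h. fst h * f1 z + snd h * f2 z)) (at z)"
  shows "((\<lambda>t. f (t, y)) has_real_derivative f1 (x, y)) (at x)"
    and "((\<lambda>t. f (x, t)) has_real_derivative f2 (x, y)) (at y)"
proof -
  have "((\<lambda>t. f (t, y)) has_derivative
      (\<lambda>h. fst (h, 0::real) * f1 (x, y) + snd (h, 0) * f2 (x, y))) (at x)"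
    by (rule has_derivative_compose[where f = "\<lambda>t. (t, y)" and f' = "\<lambda>h. (h, 0)" and g = f, OF _ assms])
      (auto intro!: derivative_eq_intros)
  then show "((\<lambda>t. f (t, y)) has_real_derivative f1 (x, y)) (at x)"
    by (simp add: has_field_derivative_def mult_commute_abs)
  have "((\<lambda>t. f (x, t)) has_derivative
      (\<lambda>h. fst (0::real, h) * f1 (x, y) + snd (0::real, h) * f2 (x, y))) (at y)"
    by (rule has_derivative_compose[where f = "\<lambda>t. (x, t)" and f' = "\<lambda>h. (0, h)" and g = f, OF _ assms])
      (auto intro!: derivative_eq_intros)
  then show "((\<lambda>t. f (x, t)) has_real_derivative f2 (x, y)) (at y)"
    by (simp add: has_field_derivative_def mult_commute_abs)
qed

section \<open>Integration by parts against test functions\<close>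

lemma loc_integrable_continuous:
  assumes "continuous_on UNIV f"
  shows "loc_integrable f"
  unfolding loc_integrable_def set_integrable_def
  using assms borel_measurable_continuous_onI[OF assms]
  by (auto intro: borel_integrable_compact continuous_on_subset)

lemma test_functionE:
  assumes "test_function \<phi>"
  obtains \<phi>1 \<phi>2 R where
    "\<And>z. (\<phi> has_derivative (\<lambda>h. fst h * \<phi>1 z + snd h * \<phi>2 z)) (at z)"
    "continuous_on UNIV \<phi>1" "continuous_on UNIV \<phi>2"
    "R \<ge> 0" "\<And>x y. R < \<bar>x\<bar> \<or> R < \<bar>y\<bar> \<Longrightarrow> \<phi> (x, y) = 0"
proof -
  have "Ck 1 \<phi>"
    using assms by (auto simp: test_function_def)
  then obtain \<phi>1 \<phi>2 where \<phi>:
    "\<And>z. (\<phi> has_derivative (\<lambda>h. fst h * \<phi>1 z + snd h * \<phi>2 z)) (at z)"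
    "continuous_on UNIV \<phi>1" "continuous_on UNIV \<phi>2"
    by auto
  have "bounded {x. \<phi> x \<noteq> 0}"
    using assms compact_imp_bounded bounded_subset closure_subset
    unfolding test_function_def by blast
  then obtain R where R: "R > 0" "\<And>z. \<phi> z \<noteq> 0 \<Longrightarrow> norm z \<le> R"
    unfolding bounded_pos by auto
  have "\<phi> (x, y) = 0" if "R < \<bar>x\<bar> \<or> R < \<bar>y\<bar>" for x y
    using that R(2)[of "(x, y)"] norm_fst_le[of x y] norm_snd_le[of y x] by force
  with \<phi> R(1) show ?thesis
    using that less_imp_le by blast
qed

text \<open>The product of \<open>u\<close> with a test function is C1 with bounded support, so its
  partial derivatives integrate to zero; expanding them by the product rule gives the defining
  identity.\<close>

lemma has_weak_derivative_of_C1: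
  fixes u u1 u2 :: "real \<times> real \<Rightarrow> real"
  assumes deriv: "\<And>z. (u has_derivative (\<lambda>h. fst h * u1 z + snd h * u2 z)) (at z)"
    and cont: "continuous_on UNIV u1" "continuous_on UNIV u2"
  shows "has_weak_derivative (\<lambda>z. of_real (u z)) (1, 0) (\<lambda>z. of_real (u1 z))"
    and "has_weak_derivative (\<lambda>z. of_real (u z)) (0, 1) (\<lambda>z. of_real (u2 z))"
proof -
  have u: "continuous_on UNIV u"
    using deriv by (meson has_derivative_continuous continuous_at_imp_continuous_on)
  have loc: "loc_integrable (\<lambda>z. of_real (u z))" "loc_integrable (\<lambda>z. of_real (u1 z))"
    "loc_integrable (\<lambda>z. of_real (u2 z))"
    by (intro loc_integrable_continuous continuous_intros u cont)+
  have parts: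
    "(LINT z|lborel. u z * frechet_derivative \<phi> (at z) (1, 0)) = - (LINT z|lborel. u1 z * \<phi> z)"
    "(LINT z|lborel. u z * frechet_derivative \<phi> (at z) (0, 1)) = - (LINT z|lborel. u2 z * \<phi> z)"
    if "test_function \<phi>" for \<phi>
  proof -
    obtain \<phi>1 \<phi>2 R where \<phi>:
      "\<And>z. (\<phi> has_derivative (\<lambda>h. fst h * \<phi>1 z + snd h * \<phi>2 z)) (at z)"
      "continuous_on UNIV \<phi>1" "continuous_on UNIV \<phi>2"
      "R \<ge> 0" "\<And>x y. R < \<bar>x\<bar> \<or> R < \<bar>y\<bar> \<Longrightarrow> \<phi> (x, y) = 0"
      using test_functionE[OF \<open>test_function \<phi>\<close>] by blast
    have cont_\<phi>: "continuous_on UNIV \<phi>"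
      using \<phi>(1) by (meson has_derivative_continuous continuous_at_imp_continuous_on)
    have fr: "frechet_derivative \<phi> (at z) = (\<lambda>h. fst h * \<phi>1 z + snd h * \<phi>2 z)" for z
      using frechet_derivative_at[OF \<phi>(1)] by simp
    have int: "integrable lborel (\<lambda>z. w z * \<phi> z)" if "continuous_on UNIV w" for w
    proof (rule integrable_continuous_box_support)
      show "continuous_on UNIV (\<lambda>z. w z * \<phi> z)"
        by (intro continuous_intros that cont_\<phi>)
      show "w (x, y) * \<phi> (x, y) = 0" if "R < \<bar>x\<bar> \<or> R < \<bar>y\<bar>" for x y
        using \<phi>(5)[OF that] by simp
    qed
    have cont1: "continuous_on UNIV (\<lambda>z. u1 z * \<phi> z + u z * \<phi>1 z)"
      by (intro continuous_intros u cont cont_\<phi> \<phi>)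
    have deriv1: "((\<lambda>t. u (t, y) * \<phi> (t, y)) has_real_derivative
        u1 (x, y) * \<phi> (x, y) + u (x, y) * \<phi>1 (x, y)) (at x)" for x y
      by (rule DERIV_mult'[OF partial_derivatives(1)[OF deriv]
            partial_derivatives(1)[OF \<phi>(1)], THEN DERIV_cong]) simp
    have 1: "integrable lborel (\<lambda>z. u1 z * \<phi> z + u z * \<phi>1 z)"
        "(LINT z|lborel. u1 z * \<phi> z + u z * \<phi>1 z) = 0"
      using integral_partial_fst_eq_0[where f = "\<lambda>z. u z * \<phi> z" and R = R, OF deriv1 cont1]
        \<phi>(4,5) by simp_all
    have cont2: "continuous_on UNIV (\<lambda>z. u2 z * \<phi> z + u z * \<phi>2 z)"
      by (intro continuous_intros u cont cont_\<phi> \<phi>)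
    have deriv2: "((\<lambda>t. u (x, t) * \<phi> (x, t)) has_real_derivative
        u2 (x, y) * \<phi> (x, y) + u (x, y) * \<phi>2 (x, y)) (at y)" for x y
      by (rule DERIV_mult'[OF partial_derivatives(2)[OF deriv]
            partial_derivatives(2)[OF \<phi>(1)], THEN DERIV_cong]) simp
    have 2: "integrable lborel (\<lambda>z. u2 z * \<phi> z + u z * \<phi>2 z)"
        "(LINT z|lborel. u2 z * \<phi> z + u z * \<phi>2 z) = 0"
      using integral_partial_snd_eq_0[where f = "\<lambda>z. u z * \<phi> z" and R = R, OF deriv2 cont2]
        \<phi>(4,5) by simp_all
    \<comment> \<open>Subtracting the integrable term \<open>u1 z * \<phi> z\<close> from the
      product-rule integrand, whose integral is zero, leaves exactly
      \<open>u z * \<phi>1 z\<close>.\<close>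
    show "(LINT z|lborel. u z * frechet_derivative \<phi> (at z) (1, 0)) = - (LINT z|lborel. u1 z * \<phi> z)"
      using Bochner_Integration.integral_diff[OF 1(1) int[OF cont(1)]] 1(2) by (simp add: fr)
    show "(LINT z|lborel. u z * frechet_derivative \<phi> (at z) (0, 1)) = - (LINT z|lborel. u2 z * \<phi> z)"
      using Bochner_Integration.integral_diff[OF 2(1) int[OF cont(2)]] 2(2) by (simp add: fr)
  qed
  show "has_weak_derivative (\<lambda>z. of_real (u z)) (1, 0) (\<lambda>z. of_real (u1 z))"
    "has_weak_derivative (\<lambda>z. of_real (u z)) (0, 1) (\<lambda>z. of_real (u2 z))"
    \<comment> \<open>All integrands are real functions under \<open>of_real\<close>, which commutes
      with the integral, so the real identities suffice.\<close>
    unfolding has_weak_derivative_def using loc parts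
    by (simp_all flip: of_real_mult of_real_minus)
qed


subsection \<open>Gaussians in the magnetic Sobolev space\<close>

lemma norm_prod_real_square: "(norm (z :: real \<times> real))\<^sup>2 = (fst z)\<^sup>2 + (snd z)\<^sup>2"
  by (simp add: norm_prod_def)

lemma nn_integral_gaussian_real_finite:
  assumes "c > 0"
  shows "(\<integral>\<^sup>+x. ennreal (exp (- c * x\<^sup>2)) \<partial>lborel) < \<infinity>"
proof -
  \<comment> \<open>\<open>s\<close> is the standard deviation for which the integrand is a constant
    multiple of the centred normal density.\<close>
  define s where "s = 1 / sqrt (2 * c)"
  have s: "s > 0" "s\<^sup>2 = 1 / (2 * c)"
    using assms by (auto simp: s_def power_divide)
  have "integrable lborel (\<lambda>x. sqrt (2 * pi * s\<^sup>2) * normal_density 0 s x)"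
    using s(1) by simp
  also have "(\<lambda>x. sqrt (2 * pi * s\<^sup>2) * normal_density 0 s x) = (\<lambda>x. exp (- c * x\<^sup>2))"
    using s assms by (auto simp: normal_density_def fun_eq_iff)
  finally show ?thesis
    by (simp add: integrable_iff_bounded)
qed

text \<open>The Gaussian factorises over the coordinates, so Tonelli gives the square of the
  one-dimensional integral.\<close>

lemma nn_integral_gaussian_plane_finite:
  assumes "c > 0"
  shows "(\<integral>\<^sup>+z. ennreal (exp (- c * (norm z)\<^sup>2)) \<partial>(lborel :: (real \<times> real) measure)) < \<infinity>"
proof -
  let ?I = "\<integral>\<^sup>+x. ennreal (exp (- c * x\<^sup>2)) \<partial>lborel"
  have "(\<integral>\<^sup>+z. ennreal (exp (- c * (norm z)\<^sup>2)) \<partial>(lborel :: (real \<times> real) measure))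
      = (\<integral>\<^sup>+z. ennreal (exp (- c * (fst z)\<^sup>2)) * ennreal (exp (- c * (snd z)\<^sup>2))
          \<partial>(lborel \<Otimes>\<^sub>M lborel))"
    unfolding lborel_prod
    by (simp add: norm_prod_real_square distrib_left exp_add exp_diff exp_minus
        divide_inverse flip: ennreal_mult)
  also have "\<dots> = (\<integral>\<^sup>+x. \<integral>\<^sup>+y. ennreal (exp (- c * x\<^sup>2)) * ennreal (exp (- c * y\<^sup>2))
          \<partial>lborel \<partial>lborel)"
    by (subst lborel.nn_integral_fst[symmetric]) auto
  also have "\<dots> = ?I * ?I"
    by (simp add: nn_integral_cmult nn_integral_multc)
  also have "\<dots> < \<infinity>"
    using nn_integral_gaussian_real_finite[OF assms] by (simp add: ennreal_mult_less_top)
  finally show ?thesis .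
qed

text \<open>One domination criterion serves both the Gaussian and its magnetic gradient. The finite
  integral is stated separately because positivity of the norm also relies on it.\<close>

lemma Lnorm_finite_of_gaussian_bound:
  assumes "c > 0" "K \<ge> 0" and bound: "\<And>z. norm (f z) powr q \<le> K * exp (- c * (norm z)\<^sup>2)"
  shows "(\<integral>\<^sup>+z. ennreal (norm (f z) powr q) \<partial>lborel) < \<infinity>" "Lnorm q f < \<infinity>"
proof -
  have "(\<integral>\<^sup>+z. ennreal (norm (f z) powr q) \<partial>lborel)
      \<le> (\<integral>\<^sup>+z. ennreal K * ennreal (exp (- c * (norm z)\<^sup>2)) \<partial>(lborel :: (real \<times> real) measure))"
    using bound \<open>K \<ge> 0\<close> by (intro nn_integral_mono) (simp flip: ennreal_mult)
  also have "\<dots> = ennreal K * (\<integral>\<^sup>+z. ennreal (exp (- c * (norm z)\<^sup>2)) \<partial>(lborel :: (real \<times> real) measure))"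
    by (simp add: nn_integral_cmult)
  also have "\<dots> < \<infinity>"
    using nn_integral_gaussian_plane_finite[OF \<open>c > 0\<close>] by (simp add: ennreal_mult_less_top)
  finally show "(\<integral>\<^sup>+z. ennreal (norm (f z) powr q) \<partial>lborel) < \<infinity>" .
  then show "Lnorm q f < \<infinity>"
    by (simp add: Lnorm_def Let_def)
qed

lemma continuous_on_gauss: "continuous_on S (gauss \<sigma>)"
  unfolding gauss_def [abs_def] divide_inverse by (intro continuous_intros)

lemma norm_gauss_powr: "norm (gauss \<sigma> z) powr q = exp (- (q / (2 * \<sigma>)) * (norm z)\<^sup>2)"
  by (simp add: gauss_def powr_def)

lemma Lnorm_gauss:
  assumes "\<sigma> > 0" "q > 0"
  shows "0 < Lnorm q (gauss \<sigma>)" "Lnorm q (gauss \<sigma>) < \<infinity>"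
proof -
  have c: "q / (2 * \<sigma>) > 0"
    using assms by simp
  have fin: "(\<integral>\<^sup>+z. ennreal (norm (gauss \<sigma> z) powr q) \<partial>lborel) < \<infinity>"
    and "Lnorm q (gauss \<sigma>) < \<infinity>"
    by (rule Lnorm_finite_of_gaussian_bound[OF c zero_le_one]; simp add: norm_gauss_powr)+
  then show "Lnorm q (gauss \<sigma>) < \<infinity>"
    by simp
  have [measurable]: "gauss \<sigma> \<in> borel_measurable borel"
    by (rule borel_measurable_continuous_onI[OF continuous_on_gauss])
  have "(\<integral>\<^sup>+z. ennreal (norm (gauss \<sigma> z) powr q) \<partial>lborel) \<noteq> 0"
  proof
    assume "(\<integral>\<^sup>+z. ennreal (norm (gauss \<sigma> z) powr q) \<partial>lborel) = 0"
    then have "AE z in lborel. norm (gauss \<sigma> z) powr q = 0"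
      by (subst (asm) nn_integral_0_iff_AE) auto
    \<comment> \<open>The integrand is positive everywhere, so a zero integral would make the whole
      plane a null set.\<close>
    then have "AE z in (lborel :: (real \<times> real) measure). False"
      by (simp add: gauss_def)
    then have "emeasure lborel (UNIV :: (real \<times> real) set) = 0"
      using AE_iff_measurable[of UNIV lborel "\<lambda>z :: real \<times> real. False"] by simp
    then show False
      by (simp add: emeasure_lborel_UNIV)
  qed
  \<comment> \<open>Since \<open>enn2real\<close> maps infinity to 0, positivity needs
    \<open>fin\<close> as well as a nonzero integral.\<close>
  then have "enn2real (\<integral>\<^sup>+z. ennreal (norm (gauss \<sigma> z) powr q) \<partial>lborel) > 0"
    using fin by (simp add: enn2real_positive_iff zero_less_iff_neq_zero)
  then show "0 < Lnorm q (gauss \<sigma>)"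
    using fin by (simp add: Lnorm_def Let_def)
qed

text \<open>The classical partial derivatives of the Gaussian yield an explicit magnetic gradient
  \<open>G\<close>. Membership asks for some square-integrable one, so the choice in
  \<open>magnetic_gradient\<close> need not be evaluated.\<close>

lemma gauss_in_H1A:
  assumes "\<sigma> > 0"
  shows "gauss \<sigma> \<in> H1A B"
proof -
  define v where "v = (\<lambda>z :: real \<times> real. exp (- (norm z)\<^sup>2 / (2 * \<sigma>)))"
  define v1 where "v1 = (\<lambda>z. - (fst z / \<sigma>) * v z)"
  define v2 where "v2 = (\<lambda>z. - (snd z / \<sigma>) * v z)"
  define G where "G = (\<lambda>z. (of_real (v1 z) + \<i> * of_real (fst (potential B z)) * gauss \<sigma> z,
                             of_real (v2 z) + \<i> * of_real (snd (potential B z)) * gauss \<sigma> z))"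
  have gauss: "gauss \<sigma> = (\<lambda>z. of_real (v z))"
    by (simp add: gauss_def [abs_def] v_def)
  have deriv: "(v has_derivative (\<lambda>h. fst h * v1 z + snd h * v2 z)) (at z)" for z
    unfolding v_def v1_def v2_def norm_prod_real_square using assms
    by (auto intro!: derivative_eq_intros simp: fun_eq_iff field_simps)
  have cont: "continuous_on UNIV v" "continuous_on UNIV v1" "continuous_on UNIV v2"
    unfolding v_def v1_def v2_def divide_inverse by (intro continuous_intros)+
  have "has_magnetic_gradient B (gauss \<sigma>) G"
    unfolding has_magnetic_gradient_def G_def
    using has_weak_derivative_of_C1[OF deriv cont(2,3)] unfolding gauss by blast
  moreover have "G \<in> L2"
  proof -
    have "continuous_on UNIV G"
      unfolding G_def potential_def fst_conv snd_conv
      by (intro continuous_intros continuous_on_gauss cont)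
    then have "G \<in> borel_measurable lborel"
      by (simp add: borel_measurable_continuous_onI)
    \<comment> \<open>In each component of \<open>G\<close> the derivative is real and the potential
      term imaginary, so no cross terms arise. The former contribute
      \<open>1 / \<sigma>\<^sup>2\<close> and the latter \<open>B\<^sup>2 / 4\<close> to the
      coefficient.\<close>
    define A where "A = 1 / \<sigma>\<^sup>2 + B\<^sup>2 / 4"
    have normG: "(norm (G z))\<^sup>2 = A * (norm z)\<^sup>2 * (v z)\<^sup>2" for z
    proof -
      have *: "(norm (complex_of_real a + \<i> * complex_of_real b * complex_of_real c))\<^sup>2
          = a\<^sup>2 + (b * c)\<^sup>2" for a b c
        by (simp add: cmod_power2)
      have "(norm (G z))\<^sup>2 = (v1 z)\<^sup>2 + (fst (potential B z) * v z)\<^sup>2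
          + ((v2 z)\<^sup>2 + (snd (potential B z) * v z)\<^sup>2)"
        unfolding G_def gauss norm_prod_def by (simp add: *)
      also have "\<dots> = A * (norm z)\<^sup>2 * (v z)\<^sup>2"
        using assms by (simp add: v1_def v2_def potential_def A_def norm_prod_real_square
            power_mult_distrib power_divide field_simps)
      finally show ?thesis .
    qed
    \<comment> \<open>With \<open>s\<close> as below, the squared Gaussian is
      \<open>exp (- s) * exp (- s)\<close>. One factor absorbs the quadratic growth
      \<open>2 * \<sigma> * s\<close> through \<open>s * exp (- s) \<le> 1\<close>; the other
      remains as the bound.\<close>
    have "norm (G z) powr 2 \<le> (A * (2 * \<sigma>)) * exp (- (1 / (2 * \<sigma>)) * (norm z)\<^sup>2)" for z
    proof -
      define s where "s = (norm z)\<^sup>2 / (2 * \<sigma>)"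
      have z: "(norm z)\<^sup>2 = 2 * \<sigma> * s" and "(v z)\<^sup>2 = exp (- s) * exp (- s)" and "A \<ge> 0"
        using assms by (simp_all add: s_def v_def A_def power2_eq_square)
      have "norm (G z) powr 2 = A * (2 * \<sigma>) * (s * exp (- s)) * exp (- s)"
        unfolding powr_numeral[OF norm_ge_zero] normG
        by (simp add: z \<open>(v z)\<^sup>2 = _\<close>)
      also have "\<dots> \<le> A * (2 * \<sigma>) * 1 * exp (- s)"
      proof (intro mult_right_mono mult_left_mono)
        show "s * exp (- s) \<le> 1"
          using order_trans[OF _ exp_ge_add_one_self[of s], of s] by (simp add: exp_minus field_simps)
      qed (use assms \<open>A \<ge> 0\<close> in auto)
      finally show ?thesis
        by (simp add: s_def)
    qed
    then have "Lnorm 2 G < \<infinity>"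
      by (rule Lnorm_finite_of_gaussian_bound(2)[rotated -1]) (use assms in \<open>auto simp: A_def\<close>)
    with \<open>G \<in> borel_measurable lborel\<close> show ?thesis
      by (simp add: L2_def)
  qed
  moreover have "gauss \<sigma> \<in> L2"
    using Lnorm_gauss(2)[OF assms, of 2] borel_measurable_continuous_onI[OF continuous_on_gauss]
    by (simp add: L2_def)
  ultimately show ?thesis
    by (auto simp: H1A_def)
qed


subsection \<open>Optimal constants and Gaussian quotients\<close>

lemma ereal_square_pos_finite:
  fixes x :: ereal
  assumes "0 < x" "x < \<infinity>"
  shows "0 < x\<^sup>2" "x\<^sup>2 \<noteq> \<infinity>"
  using assms by (cases x; simp)+

text \<open>Testing the inequality for an admissible \<open>C\<close> with \<open>\<psi>\<close> and
  dividing bounds \<open>C\<close> by the quotient. Division in \<open>ereal\<close> is legitimate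
  as the squared norm is positive and finite; an empty set of constants has supremum minus
  infinity.\<close>

lemma mu_le_Q_mu:
  assumes "\<psi> \<in> H1A B" "0 < Lnorm p \<psi>" "Lnorm p \<psi> < \<infinity>"
  shows "mu B p \<alpha> \<le> Q_mu B p \<alpha> \<psi>"
  unfolding mu_def
proof (rule SUP_least)
  fix C
  assume "C \<in> {C. \<forall>\<psi> \<in> H1A B.
      (Lnorm 2 (magnetic_gradient B \<psi>))\<^sup>2 + ereal \<alpha> * (Lnorm 2 \<psi>)\<^sup>2
        \<ge> ereal C * (Lnorm p \<psi>)\<^sup>2}"
  with assms(1) show "ereal C \<le> Q_mu B p \<alpha> \<psi>"
    by (simp add: Q_mu_def ereal_le_divide_pos[OF ereal_square_pos_finite[OF assms(2,3)]] mult.commute)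
qed

text \<open>Here the divisor is the \<open>L2\<close> norm, so \<open>Lnorm p \<psi>\<close> in the
  numerator may be infinite.\<close>

lemma nu_le_Q_nu:
  assumes "\<psi> \<in> H1A B" "0 < Lnorm 2 \<psi>" "Lnorm 2 \<psi> < \<infinity>"
  shows "nu B p \<beta> \<le> Q_nu B p \<beta> \<psi>"
  unfolding nu_def
proof (rule SUP_least)
  fix C
  assume "C \<in> {C. \<forall>\<psi> \<in> H1A B.
      (Lnorm 2 (magnetic_gradient B \<psi>))\<^sup>2 + ereal \<beta> * (Lnorm p \<psi>)\<^sup>2
        \<ge> ereal C * (Lnorm 2 \<psi>)\<^sup>2}"
  with assms(1) show "ereal C \<le> Q_nu B p \<beta> \<psi>"
    by (simp add: Q_nu_def ereal_le_divide_pos[OF ereal_square_pos_finite[OF assms(2,3)]] mult.commute)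
qed

section \<open>Positivity of the selected Gaussian widths\<close>

lemma sigma_plus_pos:
  assumes "B > 0" "0 < \<theta>" "\<theta> < 2"
  shows "sigma_plus B \<alpha> \<theta> > 0"
proof -
  \<comment> \<open>The added term under the root is positive for \<open>\<theta>\<close> between 0
    and 2, so the root exceeds \<open>\<alpha> * (1 - \<theta>)\<close> whatever its sign.\<close>
  have "\<bar>\<alpha> * (1 - \<theta>)\<bar> = sqrt (\<alpha>\<^sup>2 * (1 - \<theta>)\<^sup>2)"
    by (simp add: real_sqrt_mult abs_mult)
  also have "\<dots> < sqrt (\<alpha>\<^sup>2 * (1 - \<theta>)\<^sup>2 + B\<^sup>2 * \<theta> * (2 - \<theta>))"
    using assms by simp
  finally show ?thesis
    using assms unfolding sigma_plus_def by simp
qed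

text \<open>\<open>arg_min\<close> is a choice operator, so a minimiser must first be shown to
  exist. The terms linear in the width and in its reciprocal confine the search to a compact
  interval.\<close>

lemma sigma_minus_pos:
  assumes "B > 0" "\<beta> > 0"
  shows "sigma_minus B \<beta> \<theta> > 0"
proof -
  let ?g = "g_nu B \<beta> \<theta>"
  define M where "M = ?g 1"
  have kappa: "kappa \<beta> \<theta> \<ge> 0"
    using assms by (simp add: kappa_def)
  have "M \<ge> 2 * B\<^sup>2 + 8"
    using kappa by (simp add: M_def g_nu_def)
  then have M: "M \<ge> 8" "M \<ge> 2 * B\<^sup>2"
    using zero_le_power2[of B] by linarith+
  \<comment> \<open>These are the points where \<open>8 / t\<close> and
    \<open>2 * B\<^sup>2 * t\<close> equal the reference value \<open>M\<close> taken at 1. The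
    lower bounds on \<open>M\<close> put 1 between them.\<close>
  define a where "a = 8 / M"
  define b where "b = M / (2 * B\<^sup>2)"
  have "M > 0"
    using M(1) by simp
  then have "a > 0"
    by (simp add: a_def)
  have one: "1 \<in> {a..b}"
    using M \<open>B > 0\<close> by (simp add: a_def b_def divide_le_eq_1_pos le_divide_eq_1_pos)
  have "continuous_on {a..b} ?g"
    unfolding g_nu_def [abs_def] using \<open>a > 0\<close> by (intro continuous_intros) auto
  then obtain s where s: "s \<in> {a..b}" "\<And>t. t \<in> {a..b} \<Longrightarrow> ?g s \<le> ?g t"
    using continuous_attains_inf[of "{a..b}" ?g] one by auto
  have "s > 0"
    using s(1) \<open>a > 0\<close> by auto
  have "?g s \<le> ?g t" if "t > 0" for t
  proof (cases "t \<in> {a..b}")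
    case False
    have "?g s \<le> M"
      using s(2)[OF one] by (simp add: M_def)
    also have "M \<le> max (2 * B\<^sup>2 * t) (8 / t)"
    proof (cases "t < a")
      case True
      then have "M \<le> 8 / t"
        using that \<open>M > 0\<close> by (simp add: a_def field_simps)
      then show ?thesis
        by simp
    next
      case False
      with \<open>t \<notin> {a..b}\<close> have "M \<le> 2 * B\<^sup>2 * t"
        using assms by (simp add: b_def field_simps)
      then show ?thesis
        by simp
    qed
    \<comment> \<open>All three summands of \<open>g_nu\<close> are nonnegative for positive
      \<open>t\<close>, so their sum dominates each one.\<close>
    also have "\<dots> \<le> ?g t"
      using that kappa by (simp add: g_nu_def)
    finally show ?thesis .
  qed (use s in auto)
  then show ?thesis
    unfolding sigma_minus_def using \<open>s > 0\<close>
    by - (rule arg_minI[where Q = "\<lambda>x. 0 < x" and P = "\<lambda>\<sigma>. 0 < \<sigma>" and x = s], auto simp: not_less)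
qed

theorem proposition5p1:
  fixes B p \<alpha> \<beta> :: real
  assumes "B > 0"
  shows "(p > 2 \<and> \<alpha> > - B \<longrightarrow> mu B p \<alpha> \<le> mu_Gauss B p \<alpha>) \<and>
         (1 < p \<and> p < 2 \<and> \<beta> > 0 \<longrightarrow> nu B p \<beta> \<le> nu_Gauss B p \<beta>)"
proof (intro conjI impI)
  assume "p > 2 \<and> \<alpha> > - B"
  \<comment> \<open>For \<open>p > 2\<close> the parameter \<open>2 / p\<close> lies strictly
    between 0 and 1, inside the range required for \<open>sigma_plus_pos\<close>.\<close>
  then have "sigma_plus B \<alpha> (2 / p) > 0" "p > 0"
    using assms by (auto intro!: sigma_plus_pos simp: field_simps)
  then show "mu B p \<alpha> \<le> mu_Gauss B p \<alpha>"
    unfolding mu_Gauss_def by (intro mu_le_Q_mu gauss_in_H1A Lnorm_gauss)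
next
  assume "1 < p \<and> p < 2 \<and> \<beta> > 0"
  then have "sigma_minus B \<beta> (2 / p) > 0"
    using assms by (auto intro!: sigma_minus_pos)
  then show "nu B p \<beta> \<le> nu_Gauss B p \<beta>"
    unfolding nu_Gauss_def by (intro nu_le_Q_nu gauss_in_H1A Lnorm_gauss) auto
qed

end
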